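(* Let $(X,\cdot,d)$ be a metric invariant space. Then the following assertions are equivalent. (1) $(X,\cdot)$ is a quasigroup (respectively, a loop, a group, a commutative group). (2) $(\hat X,\oplus)$ is a quasigroup (respectively, a loop, a group, a commutative group). In this case, the Kuratowski operator $\gamma:(X,\cdot,d)\to(\hat X,\oplus,d_\infty)$ is an isometric isomorphism of quasigroups (respectively, of loops, groups, commutative groups).
   Context: A metric space $(X,d)$ equipped with an internal law $\cdot:X\times X\to X$, $(y,z)\mapsto yz$ (no associativity assumed) is called metric invariant if $d(xy,xz)=d(yx,zx)=d(y,z)$ for all $x,y,z\in X$. The Kuratowski operator is $\gamma:x\mapsto\delta_x$, where $\delta_x:X\to\mathbb{R}$, $\delta_x(t)=d(x,t)$. Its image is $\hat X:=\gamma(X)$, equipped with the metric $d_\infty(\gamma(a),\gamma(b)):=\sup_{x\in X}|\gamma(a)(x)-\gamma(b)(x)|$ (which equals $d(a,b)$). The inf-convolution of $\gamma(a),\gamma(b)$ is $(\gamma(a)\oplus\gamma(b))(x):=\inf\{\gamma(a)(y)+\gamma(b)(z): y,z\in X,\ yz=x\}$ for $x\in X$, with value $+\infty$ if no such pair $(y,z)$ exists. Saying that $(\hat X,\oplus)$ is a quasigroup (loop, etc.) includes that $\oplus$ is an internal law on $\hat X$, i.e. $\gamma(a)\oplus\gamma(b)\in\hat X$ for all $a,b\in X$. A quasigroup is a nonempty magma $(X,\cdot)$ such that for each pair $(a,b)$ the equation $ax=b$ has a unique solution $x$ and the equation $ya=b$ has a unique solution $y$. A loop is a quasigroup with an identity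 element; a group is an associative loop. *)

theory Defs
  imports "HOL-Analysis.Analysis" "HOL-Algebra.Group"
begin

section \<open>Magmas, quasigroups, loops and groups on a carrier set\<close>

definition magma_on :: "'a set \<Rightarrow> ('a \<Rightarrow> 'a \<Rightarrow> 'a) \<Rightarrow> bool" where
  "magma_on S f \<longleftrightarrow> (\<forall>x\<in>S. \<forall>y\<in>S. f x y \<in> S)"

definition quasigroup_on :: "'a set \<Rightarrow> ('a \<Rightarrow> 'a \<Rightarrow> 'a) \<Rightarrow> bool" where
  "quasigroup_on S f \<longleftrightarrow> S \<noteq> {} \<and> magma_on S f \<and>
     (\<forall>a\<in>S. \<forall>b\<in>S. (\<exists>!x. x \<in> S \<and> f a x = b) \<and> (\<exists>!y. y \<in> S \<and> f y a = b))"

definition identity_on :: "'a set \<Rightarrow> ('a \<Rightarrow> 'a \<Rightarrow> 'a) \<Rightarrow> 'a \<Rightarrow> bool" where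
  "identity_on S f e \<longleftrightarrow> e \<in> S \<and> (\<forall>x\<in>S. f e x = x \<and> f x e = x)"

definition loop_on :: "'a set \<Rightarrow> ('a \<Rightarrow> 'a \<Rightarrow> 'a) \<Rightarrow> bool" where
  "loop_on S f \<longleftrightarrow> quasigroup_on S f \<and> (\<exists>e. identity_on S f e)"

definition group_on :: "'a set \<Rightarrow> ('a \<Rightarrow> 'a \<Rightarrow> 'a) \<Rightarrow> bool" where
  "group_on S f \<longleftrightarrow> loop_on S f \<and> (\<forall>x\<in>S. \<forall>y\<in>S. \<forall>z\<in>S. f (f x y) z = f x (f y z))"

definition comm_group_on :: "'a set \<Rightarrow> ('a \<Rightarrow> 'a \<Rightarrow> 'a) \<Rightarrow> bool" where
  "comm_group_on S f \<longleftrightarrow> group_on S f \<and> (\<forall>x\<in>S. \<forall>y\<in>S. f x y = f y x)"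

text \<open>A group in the sense of an associative loop is a group in the sense of HOL-Algebra.\<close>

lemma group_on_iff_group:
  "group_on S f \<longleftrightarrow> (\<exists>e. group \<lparr>carrier = S, mult = f, one = e\<rparr>)"
proof
  assume g: "group_on S f"
  then obtain e where e: "identity_on S f e"
    by (auto simp: group_on_def loop_on_def)
  have as: "\<forall>x\<in>S. \<forall>y\<in>S. \<forall>z\<in>S. f (f x y) z = f x (f y z)"
    and q: "\<forall>a\<in>S. \<forall>b\<in>S. (\<exists>!x. x \<in> S \<and> f a x = b) \<and> (\<exists>!y. y \<in> S \<and> f y a = b)"
    and cl: "\<forall>x\<in>S. \<forall>y\<in>S. f x y \<in> S"
    using g unfolding group_on_def loop_on_def quasigroup_on_def magma_on_def
    by - (elim conjE, assumption)+
  have e1: "e \<in> S" "\<forall>x\<in>S. f e x = x"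
    using e by (simp_all add: identity_on_def)
  have "\<exists>y\<in>S. f y x = e" if "x \<in> S" for x
    using bspec[OF bspec[OF q that] e1(1)] by (blast dest: ex1_implies_ex)
  then have "group \<lparr>carrier = S, mult = f, one = e\<rparr>"
    by (intro groupI) (simp_all add: cl as e1)
  then show "\<exists>e. group \<lparr>carrier = S, mult = f, one = e\<rparr>" by blast
next
  assume "\<exists>e. group \<lparr>carrier = S, mult = f, one = e\<rparr>"
  then obtain e where "group \<lparr>carrier = S, mult = f, one = e\<rparr>" by blast
  then interpret G: group "\<lparr>carrier = S, mult = f, one = e\<rparr>" .
  let ?inv = "\<lambda>a. inv\<^bsub>\<lparr>carrier = S, mult = f, one = e\<rparr>\<^esub> a"
  have id: "identity_on S f e"
    using G.one_closed G.l_one G.r_one by (auto simp: identity_on_def)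
  have cl: "f x y \<in> S" if "x \<in> S" "y \<in> S" for x y
    using G.m_closed that by simp
  have as: "f (f x y) z = f x (f y z)" if "x \<in> S" "y \<in> S" "z \<in> S" for x y z
    using G.m_assoc that by simp
  have inv: "?inv a \<in> S" "f (?inv a) a = e" "f a (?inv a) = e" if "a \<in> S" for a
    using G.inv_closed G.l_inv G.r_inv that by auto
  have q: "(\<exists>!x. x \<in> S \<and> f a x = b) \<and> (\<exists>!y. y \<in> S \<and> f y a = b)" if ab: "a \<in> S" "b \<in> S" for a b
  proof -
    have e1: "f e x = x" "f x e = x" if "x \<in> S" for x
      using id that by (auto simp: identity_on_def)
    note i = inv[OF ab(1)]
    have "f (?inv a) b \<in> S" "f b (?inv a) \<in> S"
      using cl i(1) ab(2) by blast+
    moreover have "f a (f (?inv a) b) = b"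
      unfolding as[OF ab(1) i(1) ab(2), symmetric] i(3) by (rule e1(1)[OF ab(2)])
    moreover have "f (f b (?inv a)) a = b"
      unfolding as[OF ab(2) i(1) ab(1)] i(2) by (rule e1(2)[OF ab(2)])
    moreover have "x = f (?inv a) b" if "x \<in> S" "f a x = b" for x
      using as[OF i(1) ab(1) that(1)] unfolding i(2) that(2) e1(1)[OF that(1)] .
    moreover have "x = f b (?inv a)" if "x \<in> S" "f x a = b" for x
      using as[OF that(1) ab(1) i(1)] unfolding i(3) that(2) e1(2)[OF that(1)] by (rule sym)
    ultimately show ?thesis by blast
  qed
  have "quasigroup_on S f"
    unfolding quasigroup_on_def magma_on_def
  proof (intro conjI ballI)
    show "S \<noteq> {}" using id by (auto simp: identity_on_def)
  qed (use cl q in simp_all)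
  then show "group_on S f"
    unfolding group_on_def loop_on_def using id as by blast
qed

text \<open>Isomorphisms of quasigroups are bijective homomorphisms; for loops and groups
  preservation of the identity element, although automatic, is part of the definition.\<close>

definition quasigroup_iso ::
    "'a set \<Rightarrow> ('a \<Rightarrow> 'a \<Rightarrow> 'a) \<Rightarrow> 'b set \<Rightarrow> ('b \<Rightarrow> 'b \<Rightarrow> 'b) \<Rightarrow> ('a \<Rightarrow> 'b) \<Rightarrow> bool" where
  "quasigroup_iso S f T g h \<longleftrightarrow> bij_betw h S T \<and> (\<forall>x\<in>S. \<forall>y\<in>S. h (f x y) = g (h x) (h y))"

definition loop_iso ::
    "'a set \<Rightarrow> ('a \<Rightarrow> 'a \<Rightarrow> 'a) \<Rightarrow> 'b set \<Rightarrow> ('b \<Rightarrow> 'b \<Rightarrow> 'b) \<Rightarrow> ('a \<Rightarrow> 'b) \<Rightarrow> bool" where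
  "loop_iso S f T g h \<longleftrightarrow> quasigroup_iso S f T g h \<and>
     (\<forall>e. identity_on S f e \<longrightarrow> identity_on T g (h e))"

section \<open>Metric invariant spaces and the Kuratowski operator\<close>

definition metric_invariant :: "'a set \<Rightarrow> ('a \<Rightarrow> 'a \<Rightarrow> 'a) \<Rightarrow> ('a \<Rightarrow> 'a \<Rightarrow> real) \<Rightarrow> bool" where
  "metric_invariant X m d \<longleftrightarrow> Metric_space X d \<and> magma_on X m \<and>
     (\<forall>x\<in>X. \<forall>y\<in>X. \<forall>z\<in>X. d (m x y) (m x z) = d y z \<and> d (m y x) (m z x) = d y z)"

text \<open>Functions on \<open>X\<close> are modelled as functions that are \<open>undefined\<close> off \<open>X\<close>, so that equality
  of such functions is equality on \<open>X\<close>. An inf-convolution may take the value \<open>\<infinity>\<close>, so real-valued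
  functions on \<open>X\<close> are viewed as \<^typ>\<open>ereal\<close>-valued ones with finite values.\<close>

definition kuratowski :: "'a set \<Rightarrow> ('a \<Rightarrow> 'a \<Rightarrow> real) \<Rightarrow> 'a \<Rightarrow> 'a \<Rightarrow> ereal" where
  "kuratowski X d x = (\<lambda>t\<in>X. ereal (d x t))"

definition kuratowski_image :: "'a set \<Rightarrow> ('a \<Rightarrow> 'a \<Rightarrow> real) \<Rightarrow> ('a \<Rightarrow> ereal) set" where
  "kuratowski_image X d = kuratowski X d ` X"

definition sup_dist :: "'a set \<Rightarrow> ('a \<Rightarrow> ereal) \<Rightarrow> ('a \<Rightarrow> ereal) \<Rightarrow> ereal" where
  "sup_dist X f g = (SUP x\<in>X. \<bar>f x - g x\<bar>)"

text \<open>In \<^typ>\<open>ereal\<close> the infimum of the empty set is \<open>\<infinity>\<close>.\<close>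

definition inf_conv ::
    "'a set \<Rightarrow> ('a \<Rightarrow> 'a \<Rightarrow> 'a) \<Rightarrow> ('a \<Rightarrow> ereal) \<Rightarrow> ('a \<Rightarrow> ereal) \<Rightarrow> 'a \<Rightarrow> ereal" where
  "inf_conv X m f g = (\<lambda>x\<in>X. Inf {f y + g z | y z. y \<in> X \<and> z \<in> X \<and> m y z = x})"

definition isometric_on ::
    "'a set \<Rightarrow> ('a \<Rightarrow> 'a \<Rightarrow> real) \<Rightarrow> ('b \<Rightarrow> 'b \<Rightarrow> ereal) \<Rightarrow> ('a \<Rightarrow> 'b) \<Rightarrow> bool" where
  "isometric_on S d D h \<longleftrightarrow> (\<forall>a\<in>S. \<forall>b\<in>S. D (h a) (h b) = ereal (d a b))"

end

theory Submission
  imports Defs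
begin

text \<open>By invariance, \<open>d (ab) (yz) \<le> d a y + d b z\<close>, with equality for \<open>y = a\<close>. Hence
  \<open>\<gamma>(a) \<oplus> \<gamma>(b) \<ge> \<gamma>(ab)\<close>, and in a quasigroup every \<open>x\<close> is of the form \<open>az\<close>, so equality holds.
  Conversely, if \<open>\<gamma>(a) \<oplus> \<gamma>(b) = \<gamma>(c)\<close>, evaluating at \<open>ab\<close> gives \<open>d c (ab) \<le> 0\<close>, so \<open>c = ab\<close>.
  Either way the injective map \<open>\<gamma>\<close> is an isomorphism of magmas, which transports all the structures.\<close>

text \<open>The transport lemmas below run only from source to target; inverting the isomorphism
  yields the converse directions. Closure of \<open>S\<close> under \<open>f\<close> ensures that
  \<open>inv_into S h\<close> cancels \<open>h\<close> at \<open>f x y\<close>.\<close>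

lemma quasigroup_iso_inv_into:
  assumes "quasigroup_iso S f T g h" "magma_on S f"
  shows "quasigroup_iso T g S f (inv_into S h)"
  unfolding quasigroup_iso_def
proof (intro conjI ballI)
  have b: "bij_betw h S T" and hom: "\<And>x y. x \<in> S \<Longrightarrow> y \<in> S \<Longrightarrow> h (f x y) = g (h x) (h y)"
    using assms(1) by (auto simp: quasigroup_iso_def)
  show "bij_betw (inv_into S h) T S"
    using b by (rule bij_betw_inv_into)
  fix u v assume "u \<in> T" "v \<in> T"
  then obtain x y where "x \<in> S" "y \<in> S" "u = h x" "v = h y"
    using b by (auto simp: bij_betw_def)
  moreover from this have "f x y \<in> S"
    using assms(2) by (auto simp: magma_on_def)
  ultimately show "inv_into S h (g u v) = f (inv_into S h u) (inv_into S h v)"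
    using b hom by (metis bij_betw_inv_into_left)
qed

lemma magma_on_iso:
  assumes "quasigroup_iso S f T g h" "magma_on S f"
  shows "magma_on T g"
proof -
  have "T = h ` S"
    using assms(1) by (simp add: quasigroup_iso_def bij_betw_def)
  moreover have "g (h x) (h y) = h (f x y)" if "x \<in> S" "y \<in> S" for x y
    using assms(1) that by (simp add: quasigroup_iso_def)
  ultimately show ?thesis
    using assms(2) by (simp add: magma_on_def)
qed

text \<open>Solutions of \<open>g (h a) u = h b\<close> are exactly the images of solutions of
  \<open>f a x = b\<close>, and likewise for right division: existence is carried by
  \<open>h\<close>, uniqueness by its injectivity.\<close>

lemma quasigroup_on_iso:
  assumes "quasigroup_iso S f T g h" "quasigroup_on S f"
  shows "quasigroup_on T g"
proof -
  have inj: "inj_on h S" and T: "T = h ` S"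
    and hom: "\<And>x y. x \<in> S \<Longrightarrow> y \<in> S \<Longrightarrow> g (h x) (h y) = h (f x y)"
    using assms(1) by (auto simp: quasigroup_iso_def bij_betw_def)
  have cl: "\<And>x y. x \<in> S \<Longrightarrow> y \<in> S \<Longrightarrow> f x y \<in> S"
    and q: "\<And>a b. a \<in> S \<Longrightarrow> b \<in> S \<Longrightarrow>
      (\<exists>!x. x \<in> S \<and> f a x = b) \<and> (\<exists>!y. y \<in> S \<and> f y a = b)"
    using assms(2) by (simp_all add: quasigroup_on_def magma_on_def)
  have solve: "(\<exists>!x. x \<in> T \<and> g (h a) x = h b) \<and> (\<exists>!y. y \<in> T \<and> g y (h a) = h b)"
    if ab: "a \<in> S" "b \<in> S" for a b
  proof
    obtain x where x: "x \<in> S" "f a x = b" "\<And>x'. x' \<in> S \<Longrightarrow> f a x' = b \<Longrightarrow> x' = x"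
      using q[OF ab] by blast
    show "\<exists>!x. x \<in> T \<and> g (h a) x = h b"
    proof (rule ex1I[of _ "h x"])
      fix u assume "u \<in> T \<and> g (h a) u = h b"
      then show "u = h x"
        using ab x(3) cl inj by (auto simp: T hom inj_on_eq_iff)
    qed (use ab x(1,2) in \<open>simp add: T hom\<close>)
    obtain y where y: "y \<in> S" "f y a = b" "\<And>y'. y' \<in> S \<Longrightarrow> f y' a = b \<Longrightarrow> y' = y"
      using q[OF ab] by blast
    show "\<exists>!y. y \<in> T \<and> g y (h a) = h b"
    proof (rule ex1I[of _ "h y"])
      fix u assume "u \<in> T \<and> g u (h a) = h b"
      then show "u = h y"
        using ab y(3) cl inj by (auto simp: T hom inj_on_eq_iff)
    qed (use ab y(1,2) in \<open>simp add: T hom\<close>)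
  qed
  have "T \<noteq> {}" using assms(2) by (simp add: T quasigroup_on_def)
  moreover have "magma_on T g"
    using magma_on_iso[OF assms(1)] assms(2) by (simp add: quasigroup_on_def)
  ultimately show ?thesis
    using solve by (auto simp: quasigroup_on_def T)
qed

text \<open>The isomorphism is constructed from a quasigroup structure on one side; these
  implications make it available for the stronger structures too.\<close>

lemma quasigroup_on_weaken:
  "loop_on S f \<Longrightarrow> quasigroup_on S f"
  "group_on S f \<Longrightarrow> quasigroup_on S f"
  "comm_group_on S f \<Longrightarrow> quasigroup_on S f"
  by (simp_all add: comm_group_on_def group_on_def loop_on_def)

text \<open>Surjectivity of \<open>h\<close> makes \<open>h e\<close> neutral on all of
  \<open>T\<close>. This serves both the transport of loops and the identity clause of
  \<open>loop_iso\<close>.\<close>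

lemma identity_on_iso:
  assumes "quasigroup_iso S f T g h" "identity_on S f e"
  shows "identity_on T g (h e)"
proof -
  have T: "T = h ` S" and hom: "\<And>x y. x \<in> S \<Longrightarrow> y \<in> S \<Longrightarrow> g (h x) (h y) = h (f x y)"
    using assms(1) by (auto simp: quasigroup_iso_def bij_betw_def)
  with assms(2) show ?thesis
    by (simp add: identity_on_def T hom)
qed

lemma loop_on_iso:
  assumes "quasigroup_iso S f T g h" "loop_on S f"
  shows "loop_on T g"
  using quasigroup_on_iso[OF assms(1)] identity_on_iso[OF assms(1)] assms(2)
  unfolding loop_on_def by blast

lemma group_on_iso:
  assumes "quasigroup_iso S f T g h" "group_on S f"
  shows "group_on T g"
proof -
  have T: "T = h ` S" and hom: "\<And>x y. x \<in> S \<Longrightarrow> y \<in> S \<Longrightarrow> g (h x) (h y) = h (f x y)"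
    using assms(1) by (auto simp: quasigroup_iso_def bij_betw_def)
  \<comment> \<open>Closure lets \<open>hom\<close> be applied to the nested products in the
    associative law.\<close>
  have "\<And>x y. x \<in> S \<Longrightarrow> y \<in> S \<Longrightarrow> f x y \<in> S"
    using assms(2) by (simp add: group_on_def loop_on_def quasigroup_on_def magma_on_def)
  with assms loop_on_iso[OF assms(1)] show ?thesis
    by (auto simp: group_on_def T hom)
qed

lemma comm_group_on_iso:
  assumes "quasigroup_iso S f T g h" "comm_group_on S f"
  shows "comm_group_on T g"
proof -
  have T: "T = h ` S" and hom: "\<And>x y. x \<in> S \<Longrightarrow> y \<in> S \<Longrightarrow> g (h x) (h y) = h (f x y)"
    using assms(1) by (auto simp: quasigroup_iso_def bij_betw_def)
  with assms group_on_iso[OF assms(1)] show ?thesis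
    by (auto simp: comm_group_on_def T hom)
qed

lemma isometric_on_kuratowski:
  assumes "Metric_space X d"
  shows "isometric_on X d (sup_dist X) (kuratowski X d)"
  unfolding isometric_on_def
proof (intro ballI)
  interpret Metric_space X d by fact
  fix a b assume ab: "a \<in> X" "b \<in> X"
  show "sup_dist X (kuratowski X d a) (kuratowski X d b) = ereal (d a b)"
    unfolding sup_dist_def
  proof (rule SUP_eqI)
    fix t assume "t \<in> X"
    with ab show "\<bar>kuratowski X d a t - kuratowski X d b t\<bar> \<le> ereal (d a b)"
      using triangle[of a b t] triangle[of b a t] commute[of a b]
      by (simp add: kuratowski_def)
  next
    \<comment> \<open>The supremum is attained at \<open>t = b\<close>, where \<open>d b t\<close>
      vanishes.\<close>
    fix u assume "\<And>t. t \<in> X \<Longrightarrow> \<bar>kuratowski X d a t - kuratowski X d b t\<bar> \<le> u"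
    from this[of b] show "ereal (d a b) \<le> u"
      using ab by (simp add: kuratowski_def)
  qed
qed

lemma inj_on_kuratowski:
  assumes "Metric_space X d"
  shows "inj_on (kuratowski X d) X"
proof (rule inj_onI)
  interpret Metric_space X d by fact
  fix a b assume ab: "a \<in> X" "b \<in> X" "kuratowski X d a = kuratowski X d b"
  then have "kuratowski X d a b = kuratowski X d b b" by simp
  with ab(1,2) show "a = b" by (simp add: kuratowski_def)
qed

lemma inf_conv_kuratowski_of_quasigroup:
  assumes inv: "metric_invariant X m d" and q: "quasigroup_on X m" and ab: "a \<in> X" "b \<in> X"
  shows "inf_conv X m (kuratowski X d a) (kuratowski X d b) = kuratowski X d (m a b)"
proof
  interpret Metric_space X d using inv by (simp add: metric_invariant_def)
  have cl: "m x y \<in> X" if "x \<in> X" "y \<in> X" for x y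
    using inv that by (simp add: metric_invariant_def magma_on_def)
  have L: "d (m x y) (m x z) = d y z" and R: "d (m y x) (m z x) = d y z"
    if "x \<in> X" "y \<in> X" "z \<in> X" for x y z
    using inv that by (simp_all add: metric_invariant_def)
  fix x
  show "inf_conv X m (kuratowski X d a) (kuratowski X d b) x = kuratowski X d (m a b) x"
  proof (cases "x \<in> X")
    case True
    \<comment> \<open>Left division of \<open>x\<close> by \<open>a\<close> gives the pair
      \<open>(a, z)\<close> at which the infimum is attained; in particular the infimum is not over
      the empty set.\<close>
    then obtain z where z: "z \<in> X" "m a z = x"
      using q ab unfolding quasigroup_on_def by blast
    have "Inf {kuratowski X d a y + kuratowski X d b z | y z. y \<in> X \<and> z \<in> X \<and> m y z = x}
        = ereal (d (m a b) x)"
    proof (rule Inf_eqI)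
      fix i assume "i \<in> {kuratowski X d a y + kuratowski X d b z | y z. y \<in> X \<and> z \<in> X \<and> m y z = x}"
      then obtain y z where "y \<in> X" "z \<in> X" "m y z = x" "i = ereal (d a y + d b z)"
        by (auto simp: kuratowski_def)
      then show "ereal (d (m a b) x) \<le> i"
        \<comment> \<open>The intermediate point \<open>m y b\<close> changes one factor at a time,
          so right and left invariance turn the two distances into \<open>d a y\<close> and
          \<open>d b z\<close>.\<close>
        using triangle[of "m a b" "m y b" x] L[of y b z] R[of b a y] ab cl by auto
    next
      fix u
      assume "\<And>i. i \<in> {kuratowski X d a y + kuratowski X d b z | y z. y \<in> X \<and> z \<in> X \<and> m y z = x}
        \<Longrightarrow> u \<le> i"
      \<comment> \<open>The first summand is 0, and left invariance identifies \<open>d b z\<close>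
        with the distance from \<open>m a b\<close> to \<open>m a z = x\<close>.\<close>
      then have "u \<le> kuratowski X d a a + kuratowski X d b z"
        using ab z by blast
      then show "u \<le> ereal (d (m a b) x)"
        using ab z L[of a b z] by (simp add: kuratowski_def)
    qed
    with True show ?thesis by (simp add: inf_conv_def kuratowski_def)
  \<comment> \<open>Off \<open>X\<close> both sides are \<open>undefined\<close>.\<close>
  qed (simp add: inf_conv_def kuratowski_def)
qed

lemma inf_conv_kuratowski_of_magma:
  assumes inv: "metric_invariant X m d"
    and T: "magma_on (kuratowski_image X d) (inf_conv X m)" and ab: "a \<in> X" "b \<in> X"
  shows "inf_conv X m (kuratowski X d a) (kuratowski X d b) = kuratowski X d (m a b)"
proof -
  interpret Metric_space X d using inv by (simp add: metric_invariant_def)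
  have ab': "m a b \<in> X"
    using inv ab by (simp add: metric_invariant_def magma_on_def)
  obtain c where c: "c \<in> X"
    "inf_conv X m (kuratowski X d a) (kuratowski X d b) = kuratowski X d c"
    using T ab by (auto simp: magma_on_def kuratowski_image_def)
  have "ereal (d c (m a b)) = inf_conv X m (kuratowski X d a) (kuratowski X d b) (m a b)"
    unfolding c(2) using ab' by (simp add: kuratowski_def)
  \<comment> \<open>The pair \<open>(a, b)\<close> is admissible in the infimum at
    \<open>m a b\<close>, and it contributes 0.\<close>
  also have "\<dots> \<le> kuratowski X d a a + kuratowski X d b b"
    unfolding inf_conv_def using ab ab' by (auto intro!: Inf_lower)
  also have "\<dots> = 0"
    using ab by (simp add: kuratowski_def)
  finally have "d c (m a b) = 0"
    using nonneg[of c "m a b"] by simp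
  with c ab' show ?thesis by simp
qed

text \<open>The two alternatives serve the two directions of the equivalence: the structure is known
  either on \<open>X\<close> or on the image, and both cases give the same product formula.\<close>

lemma quasigroup_iso_kuratowski:
  assumes "metric_invariant X m d"
    and "quasigroup_on X m \<or> magma_on (kuratowski_image X d) (inf_conv X m)"
  shows "quasigroup_iso X m (kuratowski_image X d) (inf_conv X m) (kuratowski X d)"
proof -
  have "inf_conv X m (kuratowski X d a) (kuratowski X d b) = kuratowski X d (m a b)"
    if "a \<in> X" "b \<in> X" for a b
    using assms(2) inf_conv_kuratowski_of_quasigroup[OF assms(1) _ that]
      inf_conv_kuratowski_of_magma[OF assms(1) _ that] by blast
  moreover have "inj_on (kuratowski X d) X"
    using assms(1) by (simp add: metric_invariant_def inj_on_kuratowski)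
  ultimately show ?thesis
    by (simp add: quasigroup_iso_def bij_betw_def kuratowski_image_def)
qed

theorem proposition1:
  fixes X :: "'a set" and m :: "'a \<Rightarrow> 'a \<Rightarrow> 'a" and d :: "'a \<Rightarrow> 'a \<Rightarrow> real"
  assumes "metric_invariant X m d"
  shows
    "((quasigroup_on X m \<longleftrightarrow> quasigroup_on (kuratowski_image X d) (inf_conv X m)) \<and>
      (loop_on X m \<longleftrightarrow> loop_on (kuratowski_image X d) (inf_conv X m)) \<and>
      (group_on X m \<longleftrightarrow> group_on (kuratowski_image X d) (inf_conv X m)) \<and>
      (comm_group_on X m \<longleftrightarrow> comm_group_on (kuratowski_image X d) (inf_conv X m))) \<and>
     (quasigroup_on X m \<longrightarrow>
        quasigroup_iso X m (kuratowski_image X d) (inf_conv X m) (kuratowski X d) \<and>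
        isometric_on X d (sup_dist X) (kuratowski X d)) \<and>
     (loop_on X m \<or> group_on X m \<or> comm_group_on X m \<longrightarrow>
        loop_iso X m (kuratowski_image X d) (inf_conv X m) (kuratowski X d) \<and>
        isometric_on X d (sup_dist X) (kuratowski X d))"
proof -
  let ?T = "kuratowski_image X d" and ?g = "inf_conv X m" and ?h = "kuratowski X d"
  have iso: "quasigroup_iso X m ?T ?g ?h" if "quasigroup_on X m"
    using assms that by (simp add: quasigroup_iso_kuratowski)
  \<comment> \<open>A quasigroup on the image includes closure under \<oplus>, which already makes
    \<gamma> an isomorphism; its inverse carries the structure back to \<open>X\<close>.\<close>
  have inv: "quasigroup_iso ?T ?g X m (inv_into X ?h)" if "quasigroup_on ?T ?g"
  proof (rule quasigroup_iso_inv_into)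
    show "quasigroup_iso X m ?T ?g ?h"
      using assms that by (simp add: quasigroup_iso_kuratowski quasigroup_on_def)
    show "magma_on X m"
      using assms by (simp add: metric_invariant_def)
  qed
  have isometric: "isometric_on X d (sup_dist X) ?h"
    using assms by (simp add: metric_invariant_def isometric_on_kuratowski)
  have "quasigroup_on X m \<longleftrightarrow> quasigroup_on ?T ?g"
    using quasigroup_on_iso[OF iso] quasigroup_on_iso[OF inv] by blast
  moreover have "loop_on X m \<longleftrightarrow> loop_on ?T ?g"
    using loop_on_iso[OF iso] loop_on_iso[OF inv]
      quasigroup_on_weaken(1)[of X m] quasigroup_on_weaken(1)[of ?T ?g] by blast
  moreover have "group_on X m \<longleftrightarrow> group_on ?T ?g"
    using group_on_iso[OF iso] group_on_iso[OF inv]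
      quasigroup_on_weaken(2)[of X m] quasigroup_on_weaken(2)[of ?T ?g] by blast
  moreover have "comm_group_on X m \<longleftrightarrow> comm_group_on ?T ?g"
    using comm_group_on_iso[OF iso] comm_group_on_iso[OF inv]
      quasigroup_on_weaken(3)[of X m] quasigroup_on_weaken(3)[of ?T ?g] by blast
  moreover have "loop_iso X m ?T ?g ?h" if "quasigroup_on X m"
    unfolding loop_iso_def using iso[OF that] identity_on_iso[OF iso[OF that]] by blast
  ultimately show ?thesis
    using iso isometric quasigroup_on_weaken[of X m] by blast
qed

end
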